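(* Let $\beta>1$, $m>0$, and let $X$ be a random variable with density $h_{\beta,m}(x)=C_{\beta,m}x^{-2\beta}e^{-m/x}$, $x\in(0,\infty)$. Let $\alpha$ satisfy $1<\alpha\le\frac32$ and $\alpha<\beta$. Then for every bounded smooth $\phi:(0,\infty)\to\mathbb R$ such that $\phi(X)$ has finite entropy, $$\mathrm{Ent}[\phi^2(X)]\le\frac{2}{\rho_{\beta,\alpha,m}}\,E\big\{X^{2\alpha}[\phi'(X)]^2\big\},$$ where $$\rho_{\beta,\alpha,m}=\begin{cases}\dfrac12\Big(\dfrac{2\beta-\alpha}{\frac32-\alpha}\Big)^{3-2\alpha}\big(m(2-\alpha)\big)^{2\alpha-2}(\alpha-1)^{5-4\alpha}, & 1<\alpha<\tfrac32,\\[2mm] \dfrac m2, & \alpha=\tfrac32\ (\text{so }\beta>\tfrac32).\end{cases}$$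
   Context: $C_{\beta,m}>0$ is the normalizing constant making $h_{\beta,m}$ a probability density on $(0,\infty)$. $\mathrm{Ent}[\phi^2(X)]=E[\phi^2(X)\log\phi^2(X)]-E[\phi^2(X)]\log E[\phi^2(X)]$. *)

theory Defs
  imports "HOL-Analysis.Analysis"
begin

definition g_dens :: "real \<Rightarrow> real \<Rightarrow> real \<Rightarrow> real" where
  "g_dens \<beta> m x = x powr (-2*\<beta>) * exp (- m / x)"

definition C_const :: "real \<Rightarrow> real \<Rightarrow> real" where
  "C_const \<beta> m = 1 / (LINT x:{0<..}|lborel. g_dens \<beta> m x)"

definition h_dens :: "real \<Rightarrow> real \<Rightarrow> real \<Rightarrow> real" where
  "h_dens \<beta> m x = C_const \<beta> m * g_dens \<beta> m x"

definition Ex :: "real \<Rightarrow> real \<Rightarrow> (real \<Rightarrow> real) \<Rightarrow> real" where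
  "Ex \<beta> m f = (LINT x:{0<..}|lborel. f x * h_dens \<beta> m x)"

definition has_Ex :: "real \<Rightarrow> real \<Rightarrow> (real \<Rightarrow> real) \<Rightarrow> bool" where
  "has_Ex \<beta> m f \<longleftrightarrow> set_integrable lborel {0<..} (\<lambda>x. f x * h_dens \<beta> m x)"

definition Ent :: "real \<Rightarrow> real \<Rightarrow> (real \<Rightarrow> real) \<Rightarrow> real" where
  "Ent \<beta> m F = Ex \<beta> m (\<lambda>x. F x * ln (F x)) - Ex \<beta> m F * ln (Ex \<beta> m F)"

definition rho :: "real \<Rightarrow> real \<Rightarrow> real \<Rightarrow> real" where
  "rho \<beta> \<alpha> m =
     (if \<alpha> = 3/2 then m / 2
      else 1/2 * ((2*\<beta> - \<alpha>) / (3/2 - \<alpha>)) powr (3 - 2*\<alpha>)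
           * (m * (2 - \<alpha>)) powr (2*\<alpha> - 2) * (\<alpha> - 1) powr (5 - 4*\<alpha>))"

text \<open>phi is smooth (C-infinity) on (0,infinity), D n being its n-th derivative.\<close>
definition smooth_derivs :: "(nat \<Rightarrow> real \<Rightarrow> real) \<Rightarrow> bool" where
  "smooth_derivs D \<longleftrightarrow> (\<forall>n. \<forall>x>0. (D n has_real_derivative D (Suc n) x) (at x))"

end

theory Submission
  imports Defs "HOL-Real_Asymp.Real_Asymp"
begin

text \<open>
  In the coordinate \<open>z = \<integral> dx / x\<^sup>\<alpha>\<close> the weighted energy becomes an ordinary Dirichlet energy and the law
  of \<open>X\<close> has density \<open>e\<^sup>-\<^sup>W\<close> with \<open>W'' \<ge> \<rho>\<close>; the constant \<open>\<rho>\<close> is the exact infimum of \<open>W''\<close>, by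
  weighted AM-GM.  The Bakry-Emery logarithmic Sobolev inequality is then proved by optimal transport
  (Cordero-Erausquin): on a compact interval let \<open>T\<close> be the monotone map pushing \<open>f d\<mu>\<close> to \<open>d\<mu>\<close> and
  \<open>\<theta> = T - id\<close> in the coordinate \<open>z\<close>.  The Monge-Ampere equation, \<open>ln t \<le> t - 1\<close> and uniform
  convexity give \<open>ln f \<le> \<theta>' - W' \<theta> - \<rho> \<theta>\<^sup>2 / 2\<close>; integrating against \<open>f d\<mu>\<close> by parts, without boundary
  terms since \<open>T\<close> fixes the endpoints, and completing the square bounds the entropy by
  \<open>1 / (2 \<rho>) \<integral> f'\<^sup>2 / f d\<mu>\<close>.  Exhausting the half line with \<open>f = \<phi>\<^sup>2 + 1 / n\<close> finishes the proof by dominated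
  convergence.
\<close>

section \<open>Monotone transport on a compact interval\<close>

text \<open>The map is \<open>G (P x)\<close>, where \<open>P\<close> and \<open>Q\<close> are the
  primitives of \<open>p\<close> and \<open>q\<close> from \<open>a\<close> and \<open>G\<close>
  inverts \<open>Q\<close>. Equal masses give \<open>P b = Q b\<close>, so both endpoints are fixed.
  The two-sided derivative is claimed only inside, because \<open>p\<close> and \<open>q\<close> are
  controlled on \<open>{a..b}\<close> alone.\<close>

lemma monotone_transport_exists:
  fixes p q :: "real \<Rightarrow> real"
  assumes ab: "a < b"
    and cp: "continuous_on {a..b} p" and cq: "continuous_on {a..b} q"
    and pp: "\<And>x. x \<in> {a..b} \<Longrightarrow> p x > 0" and pq: "\<And>x. x \<in> {a..b} \<Longrightarrow> q x > 0"
    and mass: "integral {a..b} p = integral {a..b} q"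
  obtains T where "T a = a" "T b = b" "continuous_on {a..b} T"
    "\<And>x. x \<in> {a<..<b} \<Longrightarrow> T x \<in> {a<..<b}"
    "\<And>x. x \<in> {a<..<b} \<Longrightarrow> (T has_real_derivative p x / q (T x)) (at x)"
proof -
  define P where "P = (\<lambda>x. integral {a..x} p)"
  define Q where "Q = (\<lambda>x. integral {a..x} q)"
  have dP: "(P has_real_derivative p x) (at x within {a..b})" if "x \<in> {a..b}" for x
    unfolding P_def using integral_has_real_derivative[OF cp that] .
  have dQ: "(Q has_real_derivative q x) (at x within {a..b})" if "x \<in> {a..b}" for x
    unfolding Q_def using integral_has_real_derivative[OF cq that] .
  have cP: "continuous_on {a..b} P"
    using dP by (meson DERIV_continuous continuous_on_eq_continuous_within)
  have cQ: "continuous_on {a..b} Q"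
    using dQ by (meson DERIV_continuous continuous_on_eq_continuous_within)
  have dP': "(P has_real_derivative p x) (at x)" if "x \<in> {a<..<b}" for x
    using dP[of x] that at_within_Icc_at[of a x b] by auto
  have dQ': "(Q has_real_derivative q x) (at x)" if "x \<in> {a<..<b}" for x
    using dQ[of x] that at_within_Icc_at[of a x b] by auto
  have mono: "R x < R y"
    if "continuous_on {a..b} R" "\<And>x. x \<in> {a<..<b} \<Longrightarrow> (R has_real_derivative r x) (at x)"
      "\<And>x. x \<in> {a..b} \<Longrightarrow> r x > 0" "a \<le> x" "x < y" "y \<le> b" for R r :: "real \<Rightarrow> real" and x y
  proof (rule DERIV_pos_imp_increasing_open[OF \<open>x < y\<close>])
    fix z assume "x < z" "z < y"
    then show "\<exists>D. (R has_real_derivative D) (at z) \<and> 0 < D"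
      using that by (intro exI[of _ "r z"]) auto
  next
    show "continuous_on {x..y} R"
      using that by (meson atLeastatMost_subset_iff continuous_on_subset)
  qed
  have mP: "P x < P y" if "a \<le> x" "x < y" "y \<le> b" for x y
    using mono[OF cP dP' pp that] .
  have mQ: "Q x < Q y" if "a \<le> x" "x < y" "y \<le> b" for x y
    using mono[OF cQ dQ' pq that] .
  have ends: "P a = 0" "Q a = 0" "P b = Q b"
    using mass by (auto simp: P_def Q_def)
  define G where "G = the_inv_into {a..b} Q"
  have inj: "inj_on Q {a..b}"
    by (rule inj_onI) (metis atLeastAtMost_iff linorder_neqE_linordered_idom mQ order_less_irrefl)
  have img: "Q ` {a..b} = {0..Q b}"
  proof
    show "Q ` {a..b} \<subseteq> {0..Q b}"
    proof
      fix y assume "y \<in> Q ` {a..b}"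
      then obtain x where x: "x \<in> {a..b}" "y = Q x" by auto
      have "Q a \<le> Q x" using mQ[of a x] x by (cases "a = x") auto
      moreover have "Q x \<le> Q b" using mQ[of x b] x by (cases "x = b") auto
      ultimately show "y \<in> {0..Q b}" using x ends by auto
    qed
    show "{0..Q b} \<subseteq> Q ` {a..b}"
    proof
      fix y assume "y \<in> {0..Q b}"
      then obtain x where "a \<le> x" "x \<le> b" "Q x = y"
        using IVT'[of Q a y b] cQ ends ab by auto
      then show "y \<in> Q ` {a..b}" by auto
    qed
  qed
  have GQ: "G (Q x) = x" if "x \<in> {a..b}" for x
    unfolding G_def using the_inv_into_f_f[OF inj that] .
  have QG: "Q (G y) = y" if "y \<in> {0..Q b}" for y
    unfolding G_def using f_the_inv_into_f[OF inj] that img by auto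
  have Gin: "G y \<in> {a..b}" if "y \<in> {0..Q b}" for y
    unfolding G_def using the_inv_into_into[OF inj _ subset_refl] that img by blast
  have cG: "continuous_on {0..Q b} G"
    using continuous_on_inv[OF cQ compact_Icc, of G] GQ img by auto
  have Prange: "P x \<in> {0..Q b}" if "x \<in> {a..b}" for x
    using mP[of a x] mP[of x b] that ends by (cases "a = x"; cases "x = b") auto
  have Prange': "P x \<in> {0<..<Q b}" if "x \<in> {a<..<b}" for x
    using mP[of a x] mP[of x b] that ends by auto
  have Gin': "G y \<in> {a<..<b}" if "y \<in> {0<..<Q b}" for y
  proof -
    have "G y \<noteq> a" "G y \<noteq> b" using QG[of y] ends that by auto
    then show ?thesis using Gin[of y] that by auto
  qed
  have dG: "(G has_real_derivative inverse (q (G y))) (at y)" if y: "y \<in> {0<..<Q b}" for y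
  proof (rule DERIV_inverse_function[where f = Q and a = 0 and b = "Q b"])
    show "(Q has_real_derivative q (G y)) (at (G y))"
      using dQ'[OF Gin'[OF y]] .
    show "q (G y) \<noteq> 0" using pq[of "G y"] Gin'[OF y] by auto
    show "isCont G y"
      using cG y continuous_on_interior[of "{0..Q b}" G y] by (auto simp: interior_atLeastAtMost_real)
  qed (use y QG in auto)
  show ?thesis
  proof (rule that[of "\<lambda>x. G (P x)"])
    show "G (P a) = a" using GQ[of a] ends ab by auto
    show "G (P b) = b" using GQ[of b] ends ab by auto
    show "continuous_on {a..b} (\<lambda>x. G (P x))"
      by (rule continuous_on_compose2[OF cG cP]) (use Prange in auto)
    show "G (P x) \<in> {a<..<b}" if "x \<in> {a<..<b}" for x
      using Gin'[OF Prange'[OF that]] .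
    show "((\<lambda>x. G (P x)) has_real_derivative p x / q (G (P x))) (at x)"
      if "x \<in> {a<..<b}" for x
      using DERIV_chain2[OF dG[OF Prange'[OF that]] dP'[OF that]]
      by (simp add: field_simps)
  qed
qed

section \<open>Logarithmic Sobolev inequality for a uniformly convex potential\<close>

text \<open>\<open>Z\<close> is the arc length of the metric \<open>dx / \<sigma>\<close>, and
  \<open>\<sigma> x * W' x\<close> is the derivative of \<open>W\<close> with respect to
  \<open>Z\<close>. So \<open>convex\<close> is \<open>\<rho>\<close>-uniform convexity of
  \<open>W\<close> in the coordinate \<open>Z\<close>, in the tangent-parabola form that can be
  applied directly to the pair \<open>x\<close>, \<open>T x\<close>.\<close>

locale curved_interval =
  fixes a b \<rho> :: real and W W' \<sigma> Z :: "real \<Rightarrow> real"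
  assumes ab: "a < b" and \<rho>: "\<rho> > 0"
    and \<sigma>: "\<And>x. x \<in> {a..b} \<Longrightarrow> \<sigma> x > 0" and c\<sigma>: "continuous_on {a..b} \<sigma>"
    and dW: "\<And>x. x \<in> {a..b} \<Longrightarrow> (W has_real_derivative W' x) (at x)"
    and dZ: "\<And>x. x \<in> {a..b} \<Longrightarrow> (Z has_real_derivative 1 / \<sigma> x) (at x)"
    and convex: "\<And>x y. x \<in> {a..b} \<Longrightarrow> y \<in> {a..b} \<Longrightarrow>
      W x + \<sigma> x * W' x * (Z y - Z x) + \<rho> / 2 * (Z y - Z x)\<^sup>2 \<le> W y"
begin

text \<open>The measure with density \<open>exp (- W)\<close> in the coordinate \<open>Z\<close>,
  rewritten as a density in \<open>x\<close> through \<open>dZ = dx / \<sigma>\<close>.\<close>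

definition h :: "real \<Rightarrow> real" where
  "h x = exp (- W x) / \<sigma> x"

lemma h_pos: "h x > 0" if "x \<in> {a..b}"
  unfolding h_def using \<sigma>[OF that] by simp

lemma continuous_on_h: "continuous_on {a..b} h"
proof -
  have "continuous_on {a..b} W"
    using dW by (meson DERIV_isCont continuous_at_imp_continuous_on)
  then show ?thesis
    unfolding h_def using \<sigma> by (intro continuous_intros c\<sigma>) (auto simp: less_le)
qed

text \<open>Equal masses allow the transport of \<open>f h\<close> to \<open>h\<close> with fixed
  endpoints. They also make the correction \<open>N * ln (N / M)\<close> of the general entropy
  vanish, so the left side is already the whole entropy.\<close>

lemma log_sobolev_normalized:
  fixes f f' :: "real \<Rightarrow> real"
  assumes f: "\<And>x. x \<in> {a..b} \<Longrightarrow> f x > 0"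
    and df: "\<And>x. x \<in> {a..b} \<Longrightarrow> (f has_real_derivative f' x) (at x)"
    and cf': "continuous_on {a..b} f'"
    and mass: "integral {a..b} (\<lambda>x. f x * h x) = integral {a..b} h"
  shows "integral {a..b} (\<lambda>x. f x * ln (f x) * h x)
    \<le> 1 / (2 * \<rho>) * integral {a..b} (\<lambda>x. (\<sigma> x * f' x)\<^sup>2 / f x * h x)"
proof -
  have cont: "continuous_on {a..b} u" if "\<And>x. x \<in> {a..b} \<Longrightarrow> (u has_real_derivative u' x) (at x)"
    for u u' :: "real \<Rightarrow> real"
    using that by (meson DERIV_isCont continuous_at_imp_continuous_on)
  have cW: "continuous_on {a..b} W" using cont[OF dW] .
  have cf: "continuous_on {a..b} f" using cont[OF df] .
  have cZ: "continuous_on {a..b} Z" using cont[OF dZ] .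
  note ch = continuous_on_h and h = h_pos
  obtain T where T: "T a = a" "T b = b" "continuous_on {a..b} T"
    "\<And>x. x \<in> {a<..<b} \<Longrightarrow> T x \<in> {a<..<b}"
    and dT: "\<And>x. x \<in> {a<..<b} \<Longrightarrow> (T has_real_derivative f x * h x / h (T x)) (at x)"
    using monotone_transport_exists[of a b "\<lambda>x. f x * h x" h, OF ab _ ch _ h mass]
      h f by (auto intro!: continuous_intros cf ch)
  define \<theta> where "\<theta> x = Z (T x) - Z x" for x
  define \<theta>' where "\<theta>' x = f x * h x / h (T x) / \<sigma> (T x) - 1 / \<sigma> x" for x
  \<comment> \<open>Since \<open>exp (- W x) = \<sigma> x * h x\<close>, this is the boundary term
    of the integration by parts. It vanishes at both ends because \<open>T\<close> fixes them, so
    its derivative \<open>H'\<close> integrates to 0.\<close>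
  define H where "H x = \<theta> x * f x * exp (- W x)" for x
  define H' where "H' x = (\<theta>' x * f x + \<theta> x * f' x - \<theta> x * f x * W' x) * exp (- W x)" for x
  define R where "R x = (\<sigma> x * f' x)\<^sup>2 / f x * h x" for x
  have T_in: "T x \<in> {a..b}" if "x \<in> {a..b}" for x
    using T(1,2) T(4)[of x] that by (cases "x = a \<or> x = b") auto
  have cH: "continuous_on {a..b} H"
    unfolding H_def \<theta>_def using T_in
    by (intro continuous_intros cf cW cZ continuous_on_compose2[OF cZ T(3)]) auto
  have dH: "(H has_real_derivative H' x) (at x)" if x: "x \<in> {a<..<b}" for x
  proof -
    have "((\<lambda>x. Z (T x)) has_real_derivative f x * h x / h (T x) / \<sigma> (T x)) (at x)"
      using DERIV_chain2[OF dZ[of "T x"] dT[OF x]] T(4)[OF x] by (simp add: field_simps)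
    moreover have "x \<in> {a..b}" using x by auto
    ultimately show ?thesis
      unfolding H_def \<theta>_def H'_def \<theta>'_def
      by (auto intro!: derivative_eq_intros df dW dZ simp: algebra_simps)
  qed
  \<comment> \<open>\<open>T\<close> is differentiable only inside; continuity of \<open>H\<close>
    up to the endpoints is enough here and also yields the integrability of
    \<open>H'\<close>.\<close>
  have "(H' has_integral (H b - H a)) {a..b}"
    using ab cH dH
    by (intro fundamental_theorem_of_calculus_interior)
      (auto simp: has_real_derivative_iff_has_vector_derivative)
  then have iH: "(H' has_integral 0) {a..b}"
    by (simp add: H_def \<theta>_def T)
  have cR: "continuous_on {a..b} R"
    unfolding R_def using f by (intro continuous_intros cf ch c\<sigma> cf') force
  have iR: "(R has_integral integral {a..b} R) {a..b}"
    by (intro integrable_integral integrable_continuous_interval cR)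
  have cL: "continuous_on {a..b} (\<lambda>x. f x * ln (f x) * h x)"
    using f by (intro continuous_intros cf ch) force
  have iL: "((\<lambda>x. f x * ln (f x) * h x) has_integral
      integral {a..b} (\<lambda>x. f x * ln (f x) * h x)) {a..b}"
    by (intro integrable_integral integrable_continuous_interval cL)
  have point: "f x * ln (f x) * h x \<le> H' x + 1 / (2 * \<rho>) * R x" if x: "x \<in> {a<..<b}" for x
  proof -
    have x': "x \<in> {a..b}" and y': "T x \<in> {a..b}" using x T(4)[OF x] by auto
    note pos = f[OF x'] h[OF x'] h[OF y'] \<sigma>[OF x'] \<sigma>[OF y'] \<rho>
    \<comment> \<open>the Monge-Ampere equation of the transport, in the coordinate Z\<close>
    have eq: "f x * exp (W (T x) - W x) = \<sigma> x * \<theta>' x + 1"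
      unfolding \<theta>'_def h_def using pos by (simp add: field_simps exp_diff exp_minus)
    have "ln (f x) + (W (T x) - W x) = ln (f x * exp (W (T x) - W x))"
      using pos by (simp add: ln_mult)
    \<comment> \<open>This is \<open>ln t \<le> t - 1\<close> at
      \<open>t = \<sigma> x * \<theta>' x + 1\<close>, the value given by \<open>eq\<close>.\<close>
    also have "\<dots> \<le> \<sigma> x * \<theta>' x"
      using ln_le_minus_one[of "f x * exp (W (T x) - W x)"] mult_pos_pos[OF pos(1) exp_gt_zero] eq
      by (metis add_diff_cancel_right')
    finally have "ln (f x) \<le> \<sigma> x * \<theta>' x - \<sigma> x * W' x * \<theta> x - \<rho> / 2 * (\<theta> x)\<^sup>2"
      using convex[OF x' y'] unfolding \<theta>_def by linarith
    then have "ln (f x) * (f x * h x)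
        \<le> (\<sigma> x * \<theta>' x - \<sigma> x * W' x * \<theta> x - \<rho> / 2 * (\<theta> x)\<^sup>2) * (f x * h x)"
      using pos by (intro mult_right_mono) auto
    also have "\<dots> = H' x - \<sigma> x * \<theta> x * f' x * h x - \<rho> / 2 * (\<theta> x)\<^sup>2 * f x * h x"
      unfolding H'_def h_def using pos by (simp add: field_simps)
    \<comment> \<open>Completing the square in \<open>\<theta> x\<close>: the cross term and the
      quadratic term are the energy density minus a nonnegative square.\<close>
    also have "\<dots> = H' x + 1 / (2 * \<rho>) * R x
        - (\<rho> * \<theta> x * f x + \<sigma> x * f' x)\<^sup>2 / (2 * \<rho> * f x) * h x"
      unfolding R_def using pos by (simp add: field_simps power2_eq_square)
    also have "\<dots> \<le> H' x + 1 / (2 * \<rho>) * R x"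
      using pos by simp
    finally show ?thesis by (simp add: mult_ac)
  qed
  \<comment> \<open>The pointwise bound holds only in the interior, so the integrals are compared
    over the open interval; the endpoints are a null set.\<close>
  have "integral {a..b} (\<lambda>x. f x * ln (f x) * h x) \<le> 0 + 1 / (2 * \<rho>) * integral {a..b} R"
  proof (rule has_integral_le)
    show "((\<lambda>x. f x * ln (f x) * h x) has_integral
        integral {a..b} (\<lambda>x. f x * ln (f x) * h x)) {a<..<b}"
      using iL by (simp add: has_integral_Icc_iff_Ioo)
    show "((\<lambda>x. H' x + 1 / (2 * \<rho>) * R x) has_integral
        (0 + 1 / (2 * \<rho>) * integral {a..b} R)) {a<..<b}"
      using has_integral_add[OF iH has_integral_mult_right[OF iR, of "1 / (2 * \<rho>)"]]
      by (simp add: has_integral_Icc_iff_Ioo)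
  qed (rule point)
  then show ?thesis unfolding R_def[abs_def] by simp
qed

text \<open>Follows from the normalized case by scaling \<open>f\<close> to mass \<open>M\<close>.
  The energy is homogeneous of degree 1 in \<open>f\<close>, and the logarithm of the scaling factor
  produces the terms in \<open>ln N\<close> and \<open>ln M\<close>.\<close>

lemma log_sobolev:
  fixes f f' :: "real \<Rightarrow> real"
  assumes f: "\<And>x. x \<in> {a..b} \<Longrightarrow> f x > 0"
    and df: "\<And>x. x \<in> {a..b} \<Longrightarrow> (f has_real_derivative f' x) (at x)"
    and cf': "continuous_on {a..b} f'"
  defines "M \<equiv> integral {a..b} h" and "N \<equiv> integral {a..b} (\<lambda>x. f x * h x)"
  shows "integral {a..b} (\<lambda>x. f x * ln (f x) * h x) - N * ln N + N * ln M
    \<le> 1 / (2 * \<rho>) * integral {a..b} (\<lambda>x. (\<sigma> x * f' x)\<^sup>2 / f x * h x)"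
proof -
  have cf: "continuous_on {a..b} f"
    using df by (meson DERIV_isCont continuous_at_imp_continuous_on)
  have cfh: "continuous_on {a..b} (\<lambda>x. f x * h x)"
    by (intro continuous_intros cf continuous_on_h)
  have cL: "continuous_on {a..b} (\<lambda>x. f x * ln (f x) * h x)"
    using f by (intro continuous_intros cf continuous_on_h) force
  have pos: "integral {a..b} u > 0"
    if "continuous_on {a..b} u" "\<And>x. x \<in> {a..b} \<Longrightarrow> u x > 0" for u :: "real \<Rightarrow> real"
  proof -
    have "integral {a..b} (\<lambda>_. 0) < integral {a..b} u"
      using that ab by (intro integral_less_real) auto
    then show ?thesis by simp
  qed
  have M: "M > 0" unfolding M_def using continuous_on_h h_pos by (rule pos)
  have N: "N > 0" unfolding N_def using cfh by (rule pos) (use f h_pos in auto)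
  define c where "c = M / N"
  have c: "c > 0" using M N by (simp add: c_def)
  have "integral {a..b} (\<lambda>x. (c * f x) * ln (c * f x) * h x)
    \<le> 1 / (2 * \<rho>) * integral {a..b} (\<lambda>x. (\<sigma> x * (c * f' x))\<^sup>2 / (c * f x) * h x)"
  proof (rule log_sobolev_normalized)
    show "((\<lambda>x. c * f x) has_real_derivative c * f' x) (at x)" if "x \<in> {a..b}" for x
      using df[OF that] by (auto intro!: derivative_eq_intros)
    have "integral {a..b} (\<lambda>x. c * f x * h x) = c * N"
      unfolding N_def integral_mult_right[symmetric] by (simp add: mult_ac)
    then show "integral {a..b} (\<lambda>x. c * f x * h x) = integral {a..b} h"
      using N by (simp add: c_def M_def)
  qed (use f c cf' in \<open>auto intro!: continuous_intros\<close>)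
  also have "integral {a..b} (\<lambda>x. (\<sigma> x * (c * f' x))\<^sup>2 / (c * f x) * h x)
      = c * integral {a..b} (\<lambda>x. (\<sigma> x * f' x)\<^sup>2 / f x * h x)"
    unfolding integral_mult_right[symmetric] using c
    by (intro integral_cong) (simp add: power2_eq_square)
  also have "integral {a..b} (\<lambda>x. (c * f x) * ln (c * f x) * h x)
      = integral {a..b} (\<lambda>x. c * (f x * ln (f x) * h x) + c * ln c * (f x * h x))"
    using f c by (intro integral_cong) (simp add: ln_mult algebra_simps)
  also have "\<dots> = c * integral {a..b} (\<lambda>x. f x * ln (f x) * h x) + c * ln c * N"
    unfolding N_def
    by (subst integral_add)
      (auto intro!: integrable_continuous_interval continuous_intros cL cfh simp del: mult.assoc)
  finally have "c * (integral {a..b} (\<lambda>x. f x * ln (f x) * h x) + ln c * N)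
    \<le> c * (1 / (2 * \<rho>) * integral {a..b} (\<lambda>x. (\<sigma> x * f' x)\<^sup>2 / f x * h x))"
    by (simp add: algebra_simps)
  then have "integral {a..b} (\<lambda>x. f x * ln (f x) * h x) + ln c * N
    \<le> 1 / (2 * \<rho>) * integral {a..b} (\<lambda>x. (\<sigma> x * f' x)\<^sup>2 / f x * h x)"
    using c by (rule mult_left_le_imp_le)
  then show ?thesis
    using M N by (simp add: c_def ln_div algebra_simps)
qed

end

section \<open>Tools for the passage to the half line\<close>

text \<open>Both signs come from \<open>ln t \<le> t - 1\<close>, at \<open>t = x\<close> and at
  \<open>t = 1 / x\<close>. The bound dominates the entropy integrands uniformly.\<close>

lemma abs_x_ln_x_le:
  fixes x :: real
  assumes "x \<ge> 0"
  shows "\<bar>x * ln x\<bar> \<le> 1 + x\<^sup>2"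
proof (cases "x = 0")
  case False
  then have x: "x > 0" using assms by simp
  have "x * ln x \<le> x * (x - 1)"
    using ln_le_minus_one[OF x] x by (intro mult_left_mono) auto
  moreover have "x * ln (1 / x) \<le> x * (1 / x - 1)"
    using ln_le_minus_one[of "1 / x"] x by (intro mult_left_mono) auto
  ultimately show ?thesis
    using x by (auto simp: ln_div algebra_simps power2_eq_square abs_le_iff) (smt (verit) zero_le_square)+
qed simp

text \<open>The value 0 of the product at 0 agrees with its limit there. This is what handles the
  zeros of \<open>\<phi>\<close> when the regularization is removed.\<close>

lemma continuous_on_x_ln_x: "continuous_on {0..} (\<lambda>x::real. x * ln x)"
  unfolding continuous_on_eq_continuous_within
proof
  fix x :: real assume "x \<in> {0..}"
  show "continuous (at x within {0..}) (\<lambda>x. x * ln x)"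
  proof (cases "x = 0")
    case True
    have "((\<lambda>x::real. x * ln x) \<longlongrightarrow> 0) (at_right 0)"
      by real_asymp
    then show ?thesis
      using True by (simp add: continuous_within at_within_Ici_at_right)
  next
    case False
    then show ?thesis by (intro continuous_intros) auto
  qed
qed

text \<open>Dominated convergence with majorant \<open>K * \<bar>h x\<bar>\<close>. The shift by 2
  makes every interval nondegenerate, also for \<open>n = 0\<close>.\<close>

lemma set_integral_exhaustion_tendsto:
  fixes u :: "nat \<Rightarrow> real \<Rightarrow> real" and v h :: "real \<Rightarrow> real"
  assumes h: "set_integrable lborel {0<..} h"
    and cu: "\<And>n. continuous_on {0<..} (u n)"
    and lim: "\<And>x. x > 0 \<Longrightarrow> (\<lambda>n. u n x) \<longlonglongrightarrow> v x"
    and bound: "\<And>n x. x > 0 \<Longrightarrow> \<bar>u n x\<bar> \<le> K"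
  shows "(\<lambda>n. LINT x:{1 / real (n + 2)..real (n + 2)}|lborel. u n x * h x)
    \<longlonglongrightarrow> (LINT x:{0<..}|lborel. v x * h x)"
proof -
  define A where "A n = {1 / real (n + 2)..real (n + 2)}" for n
  define s where "s n x = indicat_real (A n) x *\<^sub>R (u n x * h x)" for n x
  define g where "g x = indicat_real {0<..} x *\<^sub>R (v x * h x)" for x
  define w where "w x = K * \<bar>indicat_real {0<..} x *\<^sub>R h x\<bar>" for x
  have A_pos: "A n \<subseteq> {0<..}" for n
  proof
    fix x assume "x \<in> A n"
    moreover have "0 < 1 / real (n + 2)" by simp
    ultimately show "x \<in> {0<..}"
      unfolding A_def by (metis atLeastAtMost_iff greaterThan_iff order_less_le_trans)
  qed
  have ih: "integrable lborel (\<lambda>x. indicat_real {0<..} x *\<^sub>R h x)"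
    using h by (simp add: set_integrable_def)
  have s_meas: "s n \<in> borel_measurable lborel" for n
  proof -
    have "(\<lambda>x. indicat_real (A n) x *\<^sub>R u n x) \<in> borel_measurable borel"
      using continuous_on_subset[OF cu A_pos]
      by (intro borel_measurable_continuous_on_indicator) (auto simp: A_def)
    \<comment> \<open>Neither \<open>u n\<close> nor \<open>h\<close> is known to be measurable on
      the whole line, so each factor carries its own cutoff.\<close>
    then have "(\<lambda>x. (indicat_real (A n) x *\<^sub>R u n x) * (indicat_real {0<..} x *\<^sub>R h x))
        \<in> borel_measurable lborel"
      using ih by (intro borel_measurable_times) (auto simp: measurable_lborel2)
    also have "(\<lambda>x. (indicat_real (A n) x *\<^sub>R u n x) * (indicat_real {0<..} x *\<^sub>R h x)) = s n"
      using A_pos[of n] by (auto simp: s_def fun_eq_iff indicator_def)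
    finally show ?thesis .
  qed
  have s_lim: "(\<lambda>n. s n x) \<longlonglongrightarrow> g x" for x
  proof (cases "x > 0")
    case True
    have "eventually (\<lambda>n. 1 / real (n + 2) \<le> x \<and> x \<le> real (n + 2)) sequentially"
    proof (rule eventually_conj)
      have "(\<lambda>n. 1 / real (n + 2)) \<longlonglongrightarrow> 0" by real_asymp
      then show "eventually (\<lambda>n. 1 / real (n + 2) \<le> x) sequentially"
        using order_tendstoD(2)[OF _ True] by (blast intro: eventually_mono less_imp_le)
      have "filterlim (\<lambda>n. real (n + 2)) at_top sequentially" by real_asymp
      then show "eventually (\<lambda>n. x \<le> real (n + 2)) sequentially"
        by (simp add: filterlim_at_top)
    qed
    then have "eventually (\<lambda>n. u n x * h x = s n x) sequentially"
      by eventually_elim (auto simp: s_def A_def)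
    moreover have "(\<lambda>n. u n x * h x) \<longlonglongrightarrow> g x"
      using True by (auto simp: g_def intro!: tendsto_intros lim)
    ultimately show ?thesis by (rule Lim_transform_eventually[rotated])
  next
    case False
    then have "s n x = 0" for n using A_pos[of n] by (auto simp: s_def indicator_def)
    then show ?thesis using False by (simp add: g_def)
  qed
  have "(\<lambda>n. integral\<^sup>L lborel (s n)) \<longlonglongrightarrow> integral\<^sup>L lborel g"
  proof (rule integral_dominated_convergence[where w = w])
    show "g \<in> borel_measurable lborel"
      using borel_measurable_LIMSEQ_real[of lborel s g] s_lim s_meas by blast
    show "integrable lborel w"
      unfolding w_def using ih by (intro integrable_mult_right integrable_abs)
    show "AE x in lborel. norm (s n x) \<le> w x" for n
    proof (rule AE_I2)
      fix x
      show "norm (s n x) \<le> w x"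
      proof (cases "x > 0")
        case True
        then have "\<bar>u n x\<bar> * \<bar>h x\<bar> \<le> K * \<bar>h x\<bar>"
          by (intro mult_right_mono bound) auto
        moreover have "0 \<le> K * \<bar>h x\<bar>" using bound[OF True, of n] by simp
        ultimately show ?thesis using True by (auto simp: s_def w_def abs_mult indicator_def)
      next
        case False
        then show ?thesis using A_pos[of n] by (auto simp: s_def w_def indicator_def)
      qed
    qed
  qed (use s_meas s_lim in auto)
  then show ?thesis
    unfolding s_def[abs_def] g_def[abs_def] A_def set_lebesgue_integral_def .
qed

section \<open>The curvature bound and its constant\<close>

lemma rho_pos:
  assumes "m > 0" "1 < \<alpha>" "\<alpha> \<le> 3/2" "\<alpha> < \<beta>"
  shows "rho \<beta> \<alpha> m > 0"
  using assms by (auto simp: rho_def)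

text \<open>The right side is the second derivative of
  \<open>(2 * \<beta> - \<alpha>) * ln x + m / x\<close> in the coordinate with
  \<open>dz = dx / x powr \<alpha>\<close>. For \<open>\<alpha> < 3/2\<close> its exponents are
  \<open>p > 0\<close> and \<open>- q < 0\<close> with \<open>p + q = 1\<close>, so AM-GM with
  weights \<open>q\<close> and \<open>p\<close> eliminates \<open>x\<close>. At
  \<open>\<alpha> = 3/2\<close> the second term is the constant \<open>m / 2\<close>.\<close>

lemma rho_le_curvature:
  assumes m: "m > 0" and \<alpha>: "1 < \<alpha>" "\<alpha> \<le> 3/2" "\<alpha> < \<beta>" and x: "x > 0"
  shows "rho \<beta> \<alpha> m
    \<le> (2 * \<beta> - \<alpha>) * (\<alpha> - 1) * x powr (2 * \<alpha> - 2) + m * (2 - \<alpha>) * x powr (2 * \<alpha> - 3)"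
proof (cases "\<alpha> = 3/2")
  case True
  have "(2 * \<beta> - \<alpha>) * (\<alpha> - 1) * x powr (2 * \<alpha> - 2) \<ge> 0"
    using \<alpha> by simp
  moreover have "2 - \<alpha> = 1 / 2" "2 * \<alpha> - 3 = 0" using True by auto
  ultimately show ?thesis using x True unfolding rho_def by (simp only: powr_zero_eq_one) simp
next
  case False
  define p where "p = 2 * \<alpha> - 2"
  define q where "q = 3 - 2 * \<alpha>"
  define A where "A = (2 * \<beta> - \<alpha>) * (\<alpha> - 1)"
  define B where "B = m * (2 - \<alpha>)"
  have pos: "p > 0" "q > 0" "A > 0" "B > 0"
    using False assms by (auto simp: p_def q_def A_def B_def)
  have pq: "p + q = 1" by (simp add: p_def q_def)
  \<comment> \<open>Here \<open>p = 2 * (\<alpha> - 1)\<close> and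
    \<open>q = 2 * (3/2 - \<alpha>)\<close>. The powers of 2 combine to \<open>1/2\<close> and those
    of \<open>\<alpha> - 1\<close> to the exponent \<open>q - p = 5 - 4 * \<alpha>\<close>.\<close>
  have "rho \<beta> \<alpha> m = (A / q) powr q * (B / p) powr p"
  proof -
    define E where "E = (2 * \<beta> - \<alpha>) / (3/2 - \<alpha>)"
    have E: "E \<ge> 0" using pos(2) \<alpha> by (simp add: E_def q_def)
    have Aq: "A / q = E * ((\<alpha> - 1) / 2)"
      using pos(2) by (simp add: A_def q_def E_def field_simps)
    have 1: "(A / q) powr q
        = E powr q * ((\<alpha> - 1) powr q / 2 powr q)"
      unfolding Aq using \<alpha> E by (simp add: powr_mult powr_divide)
    have "(2 * (\<alpha> - 1)) powr p = 2 powr p * (\<alpha> - 1) powr p"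
      by (rule powr_mult)
    then have "p powr p = 2 powr p * (\<alpha> - 1) powr p"
      by (simp add: p_def algebra_simps)
    then have 2: "(B / p) powr p = B powr p / (2 powr p * (\<alpha> - 1) powr p)"
      using pos by (simp add: powr_divide)
    have 3: "(\<alpha> - 1) powr (5 - 4 * \<alpha>) = (\<alpha> - 1) powr q / (\<alpha> - 1) powr p"
      unfolding powr_diff[symmetric] by (simp add: p_def q_def)
    have 4: "2 powr q * 2 powr p = (2::real)"
      unfolding powr_add[symmetric] using pq by (simp add: add.commute)
    have "rho \<beta> \<alpha> m = 1/2 * E powr q * B powr p
        * (\<alpha> - 1) powr (5 - 4 * \<alpha>)"
      using False by (simp add: rho_def p_def q_def B_def E_def)
    also have "\<dots> = 1 / (2 powr q * 2 powr p) * E powr q * B powr p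
        * ((\<alpha> - 1) powr q / (\<alpha> - 1) powr p)"
      by (simp only: 3 4)
    also have "\<dots> = (A / q) powr q * (B / p) powr p"
      unfolding 1 2 by (simp add: mult_ac)
    finally show ?thesis .
  qed
  \<comment> \<open>The inserted powers of \<open>x\<close> have total exponent
    \<open>p * q - q * p = 0\<close>.\<close>
  also have "\<dots> = (A * x powr p / q) powr q * (B * x powr (-q) / p) powr p"
    using pos x by (simp add: powr_mult powr_divide powr_powr powr_minus field_simps)
  also have "\<dots> \<le> q * (A * x powr p / q) + p * (B * x powr (-q) / p)"
    using pos pq x by (intro Youngs_inequality_0) auto
  also have "\<dots> = A * x powr p + B * x powr (-q)"
    using pos by simp
  finally show ?thesis
    by (simp add: A_def B_def p_def q_def)
qed

text \<open>\<open>G\<close> decreases up to \<open>x\<close> and increases afterwards, so its value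
  0 at \<open>x\<close> is the minimum over the half line.\<close>

lemma nonneg_of_deriv_sign:
  fixes G G' :: "real \<Rightarrow> real"
  assumes dG: "\<And>y. y > 0 \<Longrightarrow> (G has_real_derivative G' y) (at y)"
    and x: "x > 0" "G x = 0" and y: "y > 0"
    and up: "\<And>t. t \<ge> x \<Longrightarrow> G' t \<ge> 0"
    and down: "\<And>t. 0 < t \<Longrightarrow> t \<le> x \<Longrightarrow> G' t \<le> 0"
  shows "G y \<ge> 0"
proof (cases "x \<le> y")
  case True
  have "G x \<le> G y"
    by (rule DERIV_nonneg_imp_nondecreasing[OF True]) (metis dG order_less_le_trans up x(1))
  then show ?thesis using x by simp
next
  case False
  then have "y \<le> x" by simp
  have "G x \<le> G y"
    by (rule DERIV_nonpos_imp_nonincreasing[OF \<open>y \<le> x\<close>]) (metis dG order_less_le_trans down y)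
  then show ?thesis using x by simp
qed

text \<open>\<open>x powr (1 - \<alpha>) / (1 - \<alpha>)\<close> is the arc length of the metric \<open>dx / x powr \<alpha>\<close>, in which the
  potential \<open>(2 \<beta> - \<alpha>) ln x + m / x\<close> has second derivative at least \<open>rho \<beta> \<alpha> m\<close>.\<close>

lemma potential_uniformly_convex:
  fixes \<alpha> \<beta> m :: real
  defines "W \<equiv> \<lambda>x. (2 * \<beta> - \<alpha>) * ln x + m / x"
    and "W' \<equiv> \<lambda>x. (2 * \<beta> - \<alpha>) / x - m / x\<^sup>2"
    and "Z \<equiv> \<lambda>x. x powr (1 - \<alpha>) / (1 - \<alpha>)"
  assumes m: "m > 0" and \<alpha>: "1 < \<alpha>" "\<alpha> \<le> 3/2" "\<alpha> < \<beta>" and x: "x > 0" and y: "y > 0"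
  shows "W x + x powr \<alpha> * W' x * (Z y - Z x) + rho \<beta> \<alpha> m / 2 * (Z y - Z x)\<^sup>2 \<le> W y"
proof -
  define \<rho> where "\<rho> = rho \<beta> \<alpha> m"
  \<comment> \<open>\<open>K\<close> is the derivative of \<open>W - \<rho> / 2 * Z\<^sup>2\<close>
    with respect to \<open>Z\<close>; the curvature bound makes it nondecreasing.\<close>
  define K where "K t = t powr \<alpha> * W' t - \<rho> * Z t" for t
  define K' where "K' t = (2 * \<beta> - \<alpha>) * (\<alpha> - 1) * t powr (\<alpha> - 2)
      + m * (2 - \<alpha>) * t powr (\<alpha> - 3) - \<rho> * t powr (- \<alpha>)" for t
  \<comment> \<open>The gap between \<open>W\<close> and its tangent parabola at \<open>x\<close>.
    Its derivative is \<open>t powr (- \<alpha>) * (K t - K x)\<close>, whose sign changes at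
    \<open>x\<close>.\<close>
  define G where "G t = W t - W x - x powr \<alpha> * W' x * (Z t - Z x) - \<rho> / 2 * (Z t - Z x)\<^sup>2" for t
  have dZ: "(Z has_real_derivative t powr (- \<alpha>)) (at t)" if "t > 0" for t
    unfolding Z_def using that \<alpha> by (auto intro!: derivative_eq_intros)
  have dW: "(W has_real_derivative W' t) (at t)" if "t > 0" for t
    unfolding W_def W'_def using that
    by (auto intro!: derivative_eq_intros simp: power2_eq_square)
  have sW': "t powr \<alpha> * W' t = (2 * \<beta> - \<alpha>) * t powr (\<alpha> - 1) - m * t powr (\<alpha> - 2)" if "t > 0" for t
    using that by (simp add: W'_def powr_diff field_simps power2_eq_square)
  have dK: "(K has_real_derivative K' t) (at t)" if "t > 0" for t
  proof -
    have "((\<lambda>t. (2 * \<beta> - \<alpha>) * t powr (\<alpha> - 1) - m * t powr (\<alpha> - 2) - \<rho> * Z t)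
        has_real_derivative K' t) (at t)"
      unfolding K'_def using that
      by (auto intro!: derivative_eq_intros dZ simp: algebra_simps)
    moreover have "eventually (\<lambda>t. t > 0) (nhds t)"
      using that by (simp add: eventually_nhds_in_open[of "{0<..}", simplified])
    then have "eventually (\<lambda>t. K t
        = (2 * \<beta> - \<alpha>) * t powr (\<alpha> - 1) - m * t powr (\<alpha> - 2) - \<rho> * Z t) (nhds t)"
      by eventually_elim (simp add: K_def sW')
    ultimately show ?thesis
      by (subst DERIV_cong_ev[OF refl _ refl])
  qed
  have K'_nonneg: "K' t \<ge> 0" if "t > 0" for t
  proof -
    have "K' t = t powr (- \<alpha>) * ((2 * \<beta> - \<alpha>) * (\<alpha> - 1) * t powr (2 * \<alpha> - 2)
        + m * (2 - \<alpha>) * t powr (2 * \<alpha> - 3) - \<rho>)"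
      unfolding K'_def by (simp add: algebra_simps powr_add[symmetric])
    then show ?thesis
      using rho_le_curvature[OF m \<alpha> that] by (simp add: \<rho>_def)
  qed
  have K_mono: "K s \<le> K t" if "0 < s" "s \<le> t" for s t
    by (rule DERIV_nonneg_imp_nondecreasing[OF \<open>s \<le> t\<close>])
      (metis dK K'_nonneg order_less_le_trans that(1))
  have "G y \<ge> 0"
  proof (rule nonneg_of_deriv_sign[where G = G and x = x and G' = "\<lambda>t. t powr (- \<alpha>) * (K t - K x)"])
    fix t :: real assume t: "t > 0"
    have "(G has_real_derivative W' t - x powr \<alpha> * W' x * t powr (- \<alpha>)
        - \<rho> * (Z t - Z x) * t powr (- \<alpha>)) (at t)"
      unfolding G_def using t by (auto intro!: derivative_eq_intros dW dZ)
    also have "W' t - x powr \<alpha> * W' x * t powr (- \<alpha>) - \<rho> * (Z t - Z x) * t powr (- \<alpha>)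
        = t powr (- \<alpha>) * (K t - K x)"
      using t by (simp add: K_def powr_minus field_simps)
    finally show "(G has_real_derivative t powr (- \<alpha>) * (K t - K x)) (at t)" .
  qed (use x y K_mono in \<open>auto simp: G_def intro!: mult_nonneg_nonpos\<close>)
  then show ?thesis by (simp add: G_def \<rho>_def)
qed

section \<open>The density \<open>h_dens\<close> on a compact interval\<close>

text \<open>Convexity ignores the additive constant \<open>c\<close>, which later becomes
  \<open>ln (C_const \<beta> m)\<close> and so carries the normalization.\<close>

lemma curved_interval_h_dens:
  assumes "0 < a" "a < b" and m: "m > 0" and \<alpha>: "1 < \<alpha>" "\<alpha> \<le> 3/2" "\<alpha> < \<beta>"
  shows "curved_interval a b (rho \<beta> \<alpha> m) (\<lambda>x. (2 * \<beta> - \<alpha>) * ln x + m / x - c)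
    (\<lambda>x. (2 * \<beta> - \<alpha>) / x - m / x\<^sup>2) (\<lambda>x. x powr \<alpha>) (\<lambda>x. x powr (1 - \<alpha>) / (1 - \<alpha>))"
proof
  show "rho \<beta> \<alpha> m > 0" using rho_pos[OF m \<alpha>] .
  fix x assume x: "x \<in> {a..b}"
  then have x0: "x > 0" using assms by auto
  show "x powr \<alpha> > 0" using x0 by simp
  show "((\<lambda>x. (2 * \<beta> - \<alpha>) * ln x + m / x - c) has_real_derivative
      (2 * \<beta> - \<alpha>) / x - m / x\<^sup>2) (at x)"
    using x0 by (auto intro!: derivative_eq_intros simp: power2_eq_square)
  show "((\<lambda>x. x powr (1 - \<alpha>) / (1 - \<alpha>)) has_real_derivative 1 / x powr \<alpha>) (at x)"
    using x0 \<alpha> by (auto intro!: derivative_eq_intros simp: powr_minus_divide)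
  fix y assume y: "y \<in> {a..b}"
  then have y0: "y > 0" using assms by auto
  show "(2 * \<beta> - \<alpha>) * ln x + m / x - c + x powr \<alpha> * ((2 * \<beta> - \<alpha>) / x - m / x\<^sup>2)
      * (y powr (1 - \<alpha>) / (1 - \<alpha>) - x powr (1 - \<alpha>) / (1 - \<alpha>))
      + rho \<beta> \<alpha> m / 2 * (y powr (1 - \<alpha>) / (1 - \<alpha>) - x powr (1 - \<alpha>) / (1 - \<alpha>))\<^sup>2
      \<le> (2 * \<beta> - \<alpha>) * ln y + m / y - c"
    using potential_uniformly_convex[OF m \<alpha> x0 y0] by linarith
qed (use assms in \<open>auto intro!: continuous_intros\<close>)

text \<open>The term \<open>N * ln M\<close> stays because the truncated density has mass
  \<open>M\<close>, not 1.\<close>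

lemma log_sobolev_h_dens_interval:
  fixes f f' :: "real \<Rightarrow> real"
  assumes a: "0 < a" and b: "a < b" and m: "m > 0" and \<alpha>: "1 < \<alpha>" "\<alpha> \<le> 3/2" "\<alpha> < \<beta>"
    and C: "C_const \<beta> m > 0"
    and f: "\<And>x. x \<in> {a..b} \<Longrightarrow> f x > 0"
    and df: "\<And>x. x \<in> {a..b} \<Longrightarrow> (f has_real_derivative f' x) (at x)"
    and cf': "continuous_on {a..b} f'"
  defines "M \<equiv> LINT x:{a..b}|lborel. h_dens \<beta> m x"
    and "N \<equiv> LINT x:{a..b}|lborel. f x * h_dens \<beta> m x"
  shows "(LINT x:{a..b}|lborel. f x * ln (f x) * h_dens \<beta> m x) - N * ln N + N * ln M
    \<le> 1 / (2 * rho \<beta> \<alpha> m)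
      * (LINT x:{a..b}|lborel. x powr (2 * \<alpha>) * ((f' x)\<^sup>2 / f x) * h_dens \<beta> m x)"
proof -
  interpret curved_interval a b "rho \<beta> \<alpha> m" "\<lambda>x. (2 * \<beta> - \<alpha>) * ln x + m / x - ln (C_const \<beta> m)"
    "\<lambda>x. (2 * \<beta> - \<alpha>) / x - m / x\<^sup>2" "\<lambda>x. x powr \<alpha>" "\<lambda>x. x powr (1 - \<alpha>) / (1 - \<alpha>)"
    using curved_interval_h_dens[OF a b m \<alpha>] .
  \<comment> \<open>The potential contributes \<open>x powr (\<alpha> - 2 * \<beta>)\<close> and the
    division by \<open>\<sigma>\<close> the remaining \<open>x powr (- \<alpha>)\<close>; this is
    why the coefficient of \<open>ln x\<close> is \<open>2 * \<beta> - \<alpha>\<close>.\<close>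
  have h_eq: "h x = h_dens \<beta> m x" if "x \<in> {a..b}" for x
  proof -
    have x: "x > 0" using that a by auto
    have "h x = exp ((\<alpha> - 2 * \<beta>) * ln x + - m / x + ln (C_const \<beta> m)) / x powr \<alpha>"
      unfolding h_def by (simp add: algebra_simps)
    also have "\<dots> = x powr (\<alpha> - 2 * \<beta>) * exp (- m / x) * C_const \<beta> m / x powr \<alpha>"
      using x C by (simp only: exp_add) (simp add: powr_def)
    also have "\<dots> = h_dens \<beta> m x"
      using x by (simp add: h_dens_def g_dens_def powr_diff powr_minus field_simps)
    finally show ?thesis .
  qed
  have cf: "continuous_on {a..b} f"
    using df by (meson DERIV_isCont continuous_at_imp_continuous_on)
  have ch: "continuous_on {a..b} (h_dens \<beta> m)"
    using continuous_on_h h_eq by (metis (no_types, lifting) continuous_on_cong)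
  have LINT: "(LINT x:{a..b}|lborel. u x * h_dens \<beta> m x) = integral {a..b} (\<lambda>x. u x * h x)"
    if "continuous_on {a..b} u" for u :: "real \<Rightarrow> real"
  proof -
    have "set_integrable lborel {a..b} (\<lambda>x. u x * h_dens \<beta> m x)"
      by (intro borel_integrable_atLeastAtMost' continuous_intros that ch)
    then have "(LINT x:{a..b}|lborel. u x * h_dens \<beta> m x)
        = integral {a..b} (\<lambda>x. u x * h_dens \<beta> m x)"
      by (rule set_borel_integral_eq_integral)
    also have "\<dots> = integral {a..b} (\<lambda>x. u x * h x)"
      by (intro integral_cong) (simp add: h_eq)
    finally show ?thesis .
  qed
  have M: "M = integral {a..b} h"
    using LINT[of "\<lambda>_. 1"] by (simp add: M_def)
  have N: "N = integral {a..b} (\<lambda>x. f x * h x)"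
    using LINT[OF cf] by (simp add: N_def)
  have "continuous_on {a..b} (\<lambda>x. f x * ln (f x))"
    using f by (intro continuous_intros cf) force
  note L = LINT[OF this]
  have "continuous_on {a..b} (\<lambda>x. x powr (2 * \<alpha>) * ((f' x)\<^sup>2 / f x))"
    using f a by (intro continuous_intros cf cf') force+
  note R = LINT[OF this]
  have R': "integral {a..b} (\<lambda>x. x powr (2 * \<alpha>) * ((f' x)\<^sup>2 / f x) * h x)
      = integral {a..b} (\<lambda>x. (x powr \<alpha> * f' x)\<^sup>2 / f x * h x)"
  proof (intro integral_cong)
    fix x assume "x \<in> {a..b}"
    have "x powr (2 * \<alpha>) = (x powr \<alpha>)\<^sup>2"
      by (simp add: power2_eq_square powr_add[symmetric])
    then show "x powr (2 * \<alpha>) * ((f' x)\<^sup>2 / f x) * h x = (x powr \<alpha> * f' x)\<^sup>2 / f x * h x"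
      by (simp add: power_mult_distrib)
  qed
  show ?thesis
    using log_sobolev[OF f df cf'] unfolding L R R' M N by simp
qed

section \<open>Exhaustion of the half line\<close>

text \<open>Integrability of the energy is assumed because the integral of a non-integrable function
  is 0 by convention; for infinite energy the informal inequality is trivial.\<close>

theorem theorem3p2:
  fixes \<beta> m \<alpha> :: real and \<phi> :: "real \<Rightarrow> real" and D :: "nat \<Rightarrow> real \<Rightarrow> real"
  assumes "\<beta> > 1" and "m > 0"
    and "1 < \<alpha>" and "\<alpha> \<le> 3/2" and "\<alpha> < \<beta>"
    and "D 0 = \<phi>" and "smooth_derivs D"
    and "\<exists>B. \<forall>x>0. \<bar>\<phi> x\<bar> \<le> B"
    and "has_Ex \<beta> m (\<lambda>x. (\<phi> x)^2 * ln ((\<phi> x)^2))"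
    and "has_Ex \<beta> m (\<lambda>x. x powr (2*\<alpha>) * (D 1 x)^2)"
  shows "Ent \<beta> m (\<lambda>x. (\<phi> x)^2)
           \<le> 2 / rho \<beta> \<alpha> m * Ex \<beta> m (\<lambda>x. x powr (2*\<alpha>) * (D 1 x)^2)"
proof (cases "C_const \<beta> m = 0")
  \<comment> \<open>junk case: a non-integrable \<open>g_dens\<close> would have integral 0 and \<open>C_const\<close> = 1 / 0 = 0\<close>
  case True
  then show ?thesis by (simp add: Ent_def Ex_def h_dens_def)
next
  case False
  define I where "I = (LINT x:{0<..}|lborel. g_dens \<beta> m x)"
  have g_nonneg: "g_dens \<beta> m x \<ge> 0" for x by (simp add: g_dens_def)
  have I0: "I \<noteq> 0" using False by (auto simp: C_const_def I_def)
  have "I \<ge> 0"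
    unfolding I_def set_lebesgue_integral_def by (intro integral_nonneg_AE) (simp add: g_nonneg)
  then have C: "C_const \<beta> m > 0" using I0 by (simp add: C_const_def I_def)
  \<comment> \<open>The same convention used in reverse: a nonzero integral forces
    integrability.\<close>
  have "set_integrable lborel {0<..} (g_dens \<beta> m)"
    using I0 not_integrable_integral_eq unfolding I_def set_integrable_def set_lebesgue_integral_def by blast
  then have ih: "set_integrable lborel {0<..} (h_dens \<beta> m)"
    unfolding h_dens_def by simp
  have h_mass: "(LINT x:{0<..}|lborel. h_dens \<beta> m x) = 1"
    unfolding h_dens_def using I0 by (simp add: C_const_def I_def)
  have h_nonneg: "h_dens \<beta> m x \<ge> 0" for x
    using C g_nonneg by (simp add: h_dens_def)
  note m = assms(2) and \<alpha> = assms(3-5)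
  obtain B where B: "\<And>x. x > 0 \<Longrightarrow> \<bar>\<phi> x\<bar> \<le> B" using assms(8) by blast
  have d\<phi>: "(\<phi> has_real_derivative D 1 x) (at x)" if "x > 0" for x
    using assms(6,7) that by (auto simp: smooth_derivs_def)
  have dD: "(D 1 has_real_derivative D 2 x) (at x)" if "x > 0" for x
    using assms(7) that by (auto simp: smooth_derivs_def numeral_2_eq_2)
  have c\<phi>: "continuous_on {0<..} \<phi>"
    using d\<phi> by (meson DERIV_isCont continuous_at_imp_continuous_on greaterThan_iff)
  have cD: "continuous_on {0<..} (D 1)"
    using dD by (meson DERIV_isCont continuous_at_imp_continuous_on greaterThan_iff)
  define A where "A n = {1 / real (n + 2)..real (n + 2)}" for n
  \<comment> \<open>The added constant keeps the logarithm and the quotient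
    \<open>f'\<^sup>2 / f\<close> regular at zeros of \<open>\<phi>\<close>; it is at most 1, so the
    bound \<open>B\<^sup>2 + 1\<close> serves for all \<open>n\<close>.\<close>
  define f where "f n x = (\<phi> x)\<^sup>2 + 1 / real (n + 1)" for n x
  have f_pos: "f n x > 0" for n x
    unfolding f_def by (intro add_nonneg_pos) auto
  have f_le: "f n x \<le> B\<^sup>2 + 1" if "x > 0" for n x
  proof -
    have "(\<phi> x)\<^sup>2 \<le> B\<^sup>2" using B[OF that] abs_le_square_iff[of "\<phi> x" B] by force
    then show ?thesis unfolding f_def by (intro add_mono) auto
  qed
  have cf: "continuous_on {0<..} (f n)" for n
    unfolding f_def by (intro continuous_intros c\<phi>)
  have f_lim: "(\<lambda>n. f n x) \<longlonglongrightarrow> (\<phi> x)\<^sup>2" for x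
  proof -
    have "(\<lambda>n. (\<phi> x)\<^sup>2 + 1 / real (n + 1)) \<longlonglongrightarrow> (\<phi> x)\<^sup>2 + 0"
      by (intro tendsto_intros) real_asymp
    then show ?thesis by (simp add: f_def)
  qed
  have x_ln_x_lim: "(\<lambda>n. u n * ln (u n)) \<longlonglongrightarrow> l * ln l"
    if "u \<longlonglongrightarrow> l" "\<And>n. u n \<ge> 0" for u :: "nat \<Rightarrow> real" and l
  proof -
    have "l \<ge> 0" using that by (auto intro: LIMSEQ_le_const)
    then show ?thesis
      using continuous_on_tendsto_compose[OF continuous_on_x_ln_x that(1)] that(2) by auto
  qed
  define M where "M n = (LINT x:A n|lborel. h_dens \<beta> m x)" for n
  define N where "N n = (LINT x:A n|lborel. f n x * h_dens \<beta> m x)" for n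
  define L where "L n = (LINT x:A n|lborel. f n x * ln (f n x) * h_dens \<beta> m x)" for n
  define S where "S = Ex \<beta> m (\<lambda>x. x powr (2*\<alpha>) * (D 1 x)^2)"
  have M_lim: "M \<longlonglongrightarrow> 1"
    using set_integral_exhaustion_tendsto[OF ih, of "\<lambda>_ _. 1" "\<lambda>_. 1" 1] h_mass
    unfolding M_def A_def by simp
  have N_lim: "N \<longlonglongrightarrow> Ex \<beta> m (\<lambda>x. (\<phi> x)\<^sup>2)"
    unfolding N_def A_def Ex_def
    by (rule set_integral_exhaustion_tendsto[OF ih cf f_lim, where K = "B\<^sup>2 + 1"])
      (use f_le f_pos in \<open>auto simp: abs_of_pos\<close>)
  have N_nonneg: "N n \<ge> 0" for n
    unfolding N_def set_lebesgue_integral_def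
    by (intro integral_nonneg_AE) (simp add: h_nonneg less_imp_le[OF f_pos])
  have L_lim: "L \<longlonglongrightarrow> Ex \<beta> m (\<lambda>x. (\<phi> x)\<^sup>2 * ln ((\<phi> x)\<^sup>2))"
    unfolding L_def A_def Ex_def
  proof (rule set_integral_exhaustion_tendsto[OF ih, where K = "1 + (B\<^sup>2 + 1)\<^sup>2"])
    show "continuous_on {0<..} (\<lambda>x. f n x * ln (f n x))" for n
      using f_pos by (intro continuous_intros cf) (metis less_irrefl)
    show "(\<lambda>n. f n x * ln (f n x)) \<longlonglongrightarrow> (\<phi> x)\<^sup>2 * ln ((\<phi> x)\<^sup>2)" for x
      using x_ln_x_lim[OF f_lim] f_pos less_imp_le by blast
    show "\<bar>f n x * ln (f n x)\<bar> \<le> 1 + (B\<^sup>2 + 1)\<^sup>2" if "x > 0" for n x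
    proof -
      have "(f n x)\<^sup>2 \<le> (B\<^sup>2 + 1)\<^sup>2"
        using f_le[OF that] less_imp_le[OF f_pos] by (intro power_mono)
      then show ?thesis using abs_x_ln_x_le[of "f n x"] less_imp_le[OF f_pos, of n x] by linarith
    qed
  qed
  have bound: "L n - N n * ln (N n) + N n * ln (M n) \<le> 2 / rho \<beta> \<alpha> m * S" for n
  proof -
    define R where "R x = x powr (2 * \<alpha>) * ((2 * \<phi> x * D 1 x)\<^sup>2 / f n x)" for x
    have A_pos: "x > 0" if "x \<in> A n" for x
    proof -
      have "0 < 1 / real (n + 2)" by simp
      also have "\<dots> \<le> x" using that by (simp add: A_def)
      finally show ?thesis .
    qed
    have "1 / real (n + 2) \<le> 1" by simp
    then have lt: "1 / real (n + 2) < real (n + 2)" by linarith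
    have df: "(f n has_real_derivative 2 * \<phi> x * D 1 x) (at x)" if "x > 0" for x
      unfolding f_def using that by (auto intro!: derivative_eq_intros d\<phi>)
    have cR': "continuous_on (A n) (\<lambda>x. 2 * \<phi> x * D 1 x)"
      using A_pos by (intro continuous_intros continuous_on_subset[OF c\<phi>] continuous_on_subset[OF cD]) auto
    have "L n - N n * ln (N n) + N n * ln (M n)
        \<le> 1 / (2 * rho \<beta> \<alpha> m) * (LINT x:A n|lborel. R x * h_dens \<beta> m x)"
      unfolding L_def N_def M_def R_def A_def
      by (rule log_sobolev_h_dens_interval[OF _ lt m \<alpha> C f_pos])
        (use A_pos df cR' in \<open>auto simp: A_def\<close>)
    \<comment> \<open>Since \<open>(\<phi> x)\<^sup>2 \<le> f n x\<close>, the quotient is at most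
      \<open>4 * (D 1 x)\<^sup>2\<close>. This 4 turns
      \<open>1 / (2 * rho \<beta> \<alpha> m)\<close> into
      \<open>2 / rho \<beta> \<alpha> m\<close>.\<close>
    also have "(LINT x:A n|lborel. R x * h_dens \<beta> m x) \<le> 4 * S"
    proof -
      have "4 * S = (LINT x:{0<..}|lborel. 4 * (x powr (2*\<alpha>) * (D 1 x)^2 * h_dens \<beta> m x))"
        by (simp add: S_def Ex_def)
      moreover have "(LINT x:A n|lborel. R x * h_dens \<beta> m x)
          \<le> (LINT x:{0<..}|lborel. 4 * (x powr (2*\<alpha>) * (D 1 x)^2 * h_dens \<beta> m x))"
        unfolding set_lebesgue_integral_def
      proof (rule integral_mono_AE')
        have "set_integrable lborel {0<..} (\<lambda>x. 4 * (x powr (2*\<alpha>) * (D 1 x)^2 * h_dens \<beta> m x))"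
          using assms(10) unfolding has_Ex_def by (intro set_integrable_mult_right) auto
        then show "integrable lborel (\<lambda>x. indicat_real {0<..} x *\<^sub>R
            (4 * (x powr (2*\<alpha>) * (D 1 x)^2 * h_dens \<beta> m x)))"
          by (simp add: set_integrable_def)
        have "R x \<le> 4 * (x powr (2*\<alpha>) * (D 1 x)^2)" for x
        proof -
          have "(2 * \<phi> x * D 1 x)\<^sup>2 = 4 * (D 1 x)\<^sup>2 * (\<phi> x)\<^sup>2"
            by (simp add: power_mult_distrib)
          also have "\<dots> \<le> 4 * (D 1 x)\<^sup>2 * f n x"
            by (intro mult_left_mono) (auto simp: f_def)
          finally have "(2 * \<phi> x * D 1 x)\<^sup>2 / f n x \<le> 4 * (D 1 x)\<^sup>2"
            using f_pos[of n x] by (simp add: divide_le_eq)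
          then have "R x \<le> x powr (2*\<alpha>) * (4 * (D 1 x)\<^sup>2)"
            unfolding R_def by (intro mult_left_mono) auto
          then show ?thesis by simp
        qed
        then have "R x * h_dens \<beta> m x \<le> 4 * (x powr (2*\<alpha>) * (D 1 x)^2) * h_dens \<beta> m x" for x
          using h_nonneg by (intro mult_right_mono)
        then show "AE x in lborel. indicat_real (A n) x *\<^sub>R (R x * h_dens \<beta> m x)
            \<le> indicat_real {0<..} x *\<^sub>R (4 * (x powr (2*\<alpha>) * (D 1 x)^2 * h_dens \<beta> m x))"
          using A_pos h_nonneg by (intro AE_I2) (auto simp: indicator_def mult.assoc)
        show "AE x in lborel. 0 \<le> indicat_real {0<..} x *\<^sub>R
            (4 * (x powr (2*\<alpha>) * (D 1 x)^2 * h_dens \<beta> m x))"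
          using h_nonneg by (intro AE_I2) auto
      qed
      ultimately show ?thesis by simp
    qed
    finally show ?thesis
      using rho_pos[OF m \<alpha>] by (simp add: divide_right_mono mult_left_mono)
  qed
  \<comment> \<open>The truncated masses \<open>M n\<close> tend to the full mass 1, so the
    truncation correction tends to a multiple of \<open>ln 1 = 0\<close>.\<close>
  have "(\<lambda>n. L n - N n * ln (N n) + N n * ln (M n))
      \<longlonglongrightarrow> Ent \<beta> m (\<lambda>x. (\<phi> x)\<^sup>2) + Ex \<beta> m (\<lambda>x. (\<phi> x)\<^sup>2) * ln 1"
    unfolding Ent_def
    by (intro tendsto_intros L_lim N_lim M_lim x_ln_x_lim N_nonneg) simp
  then have "Ent \<beta> m (\<lambda>x. (\<phi> x)\<^sup>2) + Ex \<beta> m (\<lambda>x. (\<phi> x)\<^sup>2) * ln 1 \<le> 2 / rho \<beta> \<alpha> m * S"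
    by (rule LIMSEQ_le_const2) (use bound in auto)
  then show ?thesis by (simp add: S_def)
qed

end
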